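(* Let $\Pi=(P,L)$ be a connected and co-connected partial linear space containing two distinct non-collinear points and satisfying the following: (a) all lines in $L$ contain at least $4$ points; (b) if $x$ and $y$ are points with $x^\perp\subseteq y^\perp$, then $x=y$; (c) every triple of distinct points $x,y,z$ with $x\sim y\sim z$ and $x\perp z$ generates a transversal plane; (d) for each point $x\in P$ and each transversal plane $\pi$, the set $x^\perp\cap\pi$ is empty, a point, a line, a transversal of $\pi$, or $\pi$ itself. Then $(P,\perp)$ is a non-degenerate polar graph of rank at least $2$. Moreover, if in addition (e) $h=h^{\perp\perp}$ for all $h\in L$, then $(P,L)$ is the geometry of points and hyperbolic lines of the polar graph $(P,\perp)$, i.e. $L=\{\{x,y\}^{\perp\perp} : x,y\in P,\ x\not\perp y\}$.
   Context: A partial linear space $\Pi=(P,L)$ consists of a set $P$ of points and a set $L$ of subsets of $P$ of size at least $2$, called lines, such that two distinct points are in at most one line. Distinct points $p,q$ on a common line are called collinear, written $p\sim q$; the line through them is denoted $pq$. A point is not collinear to itself. $p\perp q$ means that $p$ and $q$ are equal or non-collinear; $p^\perp=\{q: q\perp p\}$, $p^\sim=\{q: q\sim p\}$; for $X\subseteq P$, $X^\perp=\bigcap_{x\in X}x^\perp$. $\Pi$ is connected if the graph $(P,\sim)$ is connected, and co-connected if the graph $(P,\perp)$ is connected. A subspace is a subset $X\subseteq P$ containing every line that meets it in at least two points; $\langle Y\rangle$ denotes the intersection of all subspaces containing $Y$ (the subspace generated by $Y$). A plane is a subspace generated by two distinct intersecting lines. A subspace $X$ is transversal if for each line $\ell\subseteq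 X$ the sets $x^\perp\cap X$, $x\in\ell$, partition $X$; the sets $x^\perp\cap X$ ($x \in X$) are then the transversals of $X$. A polar space is a partial linear space $(\mathcal P,\mathcal L)$ such that for each point $p$ and line $l$ with $p\notin l$, $p$ is collinear (in this space) with exactly one or all points of $l$. It is non-degenerate if no point is equal or collinear to all points. A non-degenerate polar space has rank at least $2$ iff it contains lines. $(P,\perp)$ is a non-degenerate polar graph of rank at least $2$ if there is a non-degenerate polar space of rank at least $2$ with point set $P$ in which any two points $p,q$ are equal or collinear if and only if $p\perp q$. The hyperbolic lines of such a polar space are the sets $\{x,y\}^{\perp\perp}$ with $x\not\perp y$. *)

theory Defs
  imports "HOL-Library.Disjoint_Sets"
begin

(* Infinite sets count as large, although their card is 0. *)
definition has_at_least :: "nat \<Rightarrow> 'a set \<Rightarrow> bool" where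
  "has_at_least n A \<longleftrightarrow> infinite A \<or> n \<le> card A"

definition partial_linear_space :: "'a set \<Rightarrow> 'a set set \<Rightarrow> bool" where
  "partial_linear_space P L \<longleftrightarrow>
     (\<forall>l\<in>L. l \<subseteq> P \<and> has_at_least 2 l) \<and>
     (\<forall>p\<in>P. \<forall>q\<in>P. p \<noteq> q \<longrightarrow>
        (\<forall>l\<in>L. \<forall>m\<in>L. p \<in> l \<and> q \<in> l \<and> p \<in> m \<and> q \<in> m \<longrightarrow> l = m))"

definition pls_collinear :: "'a set set \<Rightarrow> 'a \<Rightarrow> 'a \<Rightarrow> bool" where
  "pls_collinear L p q \<longleftrightarrow> p \<noteq> q \<and> (\<exists>l\<in>L. p \<in> l \<and> q \<in> l)"

(* Only meaningful for points: every use below restricts the arguments to the point set. *)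
definition orth :: "'a set set \<Rightarrow> 'a \<Rightarrow> 'a \<Rightarrow> bool" where
  "orth L p q \<longleftrightarrow> p = q \<or> \<not> pls_collinear L p q"

(* The set of all points related by R to every element of X; with R = orth L this is the
   set X-perp, and x-perp is the case X = {x}. *)
definition perp :: "'a set \<Rightarrow> ('a \<Rightarrow> 'a \<Rightarrow> bool) \<Rightarrow> 'a set \<Rightarrow> 'a set" where
  "perp P R X = {q \<in> P. \<forall>x\<in>X. R q x}"

definition connected_graph :: "'a set \<Rightarrow> ('a \<Rightarrow> 'a \<Rightarrow> bool) \<Rightarrow> bool" where
  "connected_graph P R \<longleftrightarrow>
     (\<forall>x\<in>P. \<forall>y\<in>P. (\<lambda>u v. u \<in> P \<and> v \<in> P \<and> R u v)\<^sup>*\<^sup>* x y)"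

definition pls_subspace :: "'a set \<Rightarrow> 'a set set \<Rightarrow> 'a set \<Rightarrow> bool" where
  "pls_subspace P L X \<longleftrightarrow> X \<subseteq> P \<and> (\<forall>l\<in>L. has_at_least 2 (l \<inter> X) \<longrightarrow> l \<subseteq> X)"

definition generated :: "'a set \<Rightarrow> 'a set set \<Rightarrow> 'a set \<Rightarrow> 'a set" where
  "generated P L Y = \<Inter>{X. pls_subspace P L X \<and> Y \<subseteq> X}"

definition plane :: "'a set \<Rightarrow> 'a set set \<Rightarrow> 'a set \<Rightarrow> bool" where
  "plane P L X \<longleftrightarrow>
     (\<exists>l\<in>L. \<exists>m\<in>L. l \<noteq> m \<and> l \<inter> m \<noteq> {} \<and> X = generated P L (l \<union> m))"

definition transversal_subspace :: "'a set \<Rightarrow> 'a set set \<Rightarrow> 'a set \<Rightarrow> bool" where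
  "transversal_subspace P L X \<longleftrightarrow> pls_subspace P L X \<and>
     (\<forall>l\<in>L. l \<subseteq> X \<longrightarrow> partition_on X ((\<lambda>x. perp P (orth L) {x} \<inter> X) ` l))"

definition transversals :: "'a set \<Rightarrow> 'a set set \<Rightarrow> 'a set \<Rightarrow> 'a set set" where
  "transversals P L X = (\<lambda>x. perp P (orth L) {x} \<inter> X) ` X"

definition transversal_plane :: "'a set \<Rightarrow> 'a set set \<Rightarrow> 'a set \<Rightarrow> bool" where
  "transversal_plane P L X \<longleftrightarrow> plane P L X \<and> transversal_subspace P L X"

definition polar_space :: "'a set \<Rightarrow> 'a set set \<Rightarrow> bool" where
  "polar_space P L \<longleftrightarrow> partial_linear_space P L \<and>
     (\<forall>p\<in>P. \<forall>l\<in>L. p \<notin> l \<longrightarrow>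
        (\<exists>!q. q \<in> l \<and> pls_collinear L p q) \<or> (\<forall>q\<in>l. pls_collinear L p q))"

definition nondegenerate_polar_space :: "'a set \<Rightarrow> 'a set set \<Rightarrow> bool" where
  "nondegenerate_polar_space P L \<longleftrightarrow> polar_space P L \<and>
     \<not> (\<exists>p\<in>P. \<forall>q\<in>P. p = q \<or> pls_collinear L p q)"

(* For a non-degenerate polar space, rank at least 2 means that there are lines. *)
definition nondegenerate_polar_graph_rank_ge_2 ::
    "'a set \<Rightarrow> ('a \<Rightarrow> 'a \<Rightarrow> bool) \<Rightarrow> bool" where
  "nondegenerate_polar_graph_rank_ge_2 P R \<longleftrightarrow>
     (\<exists>M. nondegenerate_polar_space P M \<and> M \<noteq> {} \<and>
        (\<forall>p\<in>P. \<forall>q\<in>P. (p = q \<or> pls_collinear M p q) \<longleftrightarrow> R p q))"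

(* The hyperbolic lines of a polar space depend only on its polar graph (P, R), where R is
   the relation of being equal or collinear in the polar space. *)
definition hyperbolic_lines :: "'a set \<Rightarrow> ('a \<Rightarrow> 'a \<Rightarrow> bool) \<Rightarrow> 'a set set" where
  "hyperbolic_lines P R = {perp P R (perp P R {x, y}) | x y. x \<in> P \<and> y \<in> P \<and> \<not> R x y}"

end

(* The lines of the polar space have to be the sets {s,t}^perp^perp with s perp t, s \<noteq> t, so the
   point is to find in each of them a point perpendicular to a given p ~ s, t. If some q satisfies
   q perp p, s and q ~ t, such a point r is visible in the transversal plane generated by q and two
   points t, t2 of the transversal of <s,p,t> on s and t: it lies on a line of that plane
   perpendicular to two points of <s,p,t>. Co-connectedness shows that {p,s}^perp is never empty,
   and reducedness (b) then that such a q always exists. Finally (b) also gives the exchange property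
   that makes two points of a set {s,t}^perp^perp determine it. *)

theory Submission
  imports Defs
begin

section \<open>Cardinality bounds for possibly infinite sets\<close>

lemma has_at_least_4_avoid:
  assumes "has_at_least 4 l"
  shows "\<exists>z\<in>l. z \<noteq> a \<and> z \<noteq> b \<and> z \<noteq> c"
proof (rule ccontr)
  assume "\<not> ?thesis"
  then have sub: "l \<subseteq> {a, b, c}"
    by blast
  then have "card l \<le> card {a, b, c}"
    by (intro card_mono) auto
  also have "\<dots> \<le> 3"
    by (simp add: card_insert_if)
  finally show False
    using assms finite_subset[OF sub] by (simp add: has_at_least_def)
qed

lemma has_at_least_2I:
  assumes "x \<in> A" "y \<in> A" "x \<noteq> y"
  shows "has_at_least 2 A"
proof (cases "finite A")
  case True
  then have "card {x, y} \<le> card A"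
    using assms by (intro card_mono) auto
  then show ?thesis
    using assms by (simp add: has_at_least_def)
qed (simp add: has_at_least_def)

lemma has_at_least_2E:
  assumes "has_at_least 2 A"
  obtains x y where "x \<in> A" "y \<in> A" "x \<noteq> y"
proof -
  have "\<not> A \<subseteq> {x}" for x
    using assms card_mono[of "{x}" A] finite_subset[of A "{x}"]
    by (auto simp: has_at_least_def)
  then show ?thesis
    using that by blast
qed

section \<open>The geometry and elementary facts about its lines\<close>

locale transversal_geometry =
  fixes P :: "'a set" and L :: "'a set set"
  assumes pls: "partial_linear_space P L"
    and connected: "connected_graph P (pls_collinear L)"
    and coconnected: "connected_graph P (orth L)"
    and line_size: "\<forall>l\<in>L. has_at_least 4 l"
    and reduced: "\<forall>x\<in>P. \<forall>y\<in>P. perp P (orth L) {x} \<subseteq> perp P (orth L) {y} \<longrightarrow> x = y"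
    and planes: "\<forall>x\<in>P. \<forall>y\<in>P. \<forall>z\<in>P. x \<noteq> y \<and> y \<noteq> z \<and> x \<noteq> z \<and>
              pls_collinear L x y \<and> pls_collinear L y z \<and> orth L x z \<longrightarrow>
              transversal_plane P L (generated P L {x, y, z})"
    and plane_perp: "\<forall>x\<in>P. \<forall>\<pi>. transversal_plane P L \<pi> \<longrightarrow>
              (let S = perp P (orth L) {x} \<inter> \<pi> in
                 S = {} \<or> (\<exists>p\<in>P. S = {p}) \<or> S \<in> L \<or> S \<in> transversals P L \<pi> \<or> S = \<pi>)"
begin

abbreviation col (infix "\<sim>" 50) where "x \<sim> y \<equiv> pls_collinear L x y"
abbreviation ort (infix "\<bottom>" 50) where "x \<bottom> y \<equiv> orth L x y"

lemma orth_iff: "x \<bottom> y \<longleftrightarrow> \<not> x \<sim> y"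
  by (auto simp: orth_def pls_collinear_def)

lemma col_sym: "x \<sim> y \<Longrightarrow> y \<sim> x"
  by (auto simp: pls_collinear_def)

lemma orth_sym: "x \<bottom> y \<Longrightarrow> y \<bottom> x"
  by (auto simp: orth_def pls_collinear_def)

lemma orth_refl [simp]: "x \<bottom> x"
  by (simp add: orth_def)

lemma perp_iff: "q \<in> perp P (orth L) X \<longleftrightarrow> q \<in> P \<and> (\<forall>x\<in>X. q \<bottom> x)"
  by (simp add: perp_def)

lemma line_points: "l \<in> L \<Longrightarrow> u \<in> l \<Longrightarrow> u \<in> P"
  using pls by (auto simp: partial_linear_space_def)

lemma line_unique:
  "\<lbrakk>l \<in> L; m \<in> L; u \<in> l; v \<in> l; u \<in> m; v \<in> m; u \<noteq> v\<rbrakk> \<Longrightarrow> l = m"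
  using pls line_points unfolding partial_linear_space_def by metis

lemma line_col: "\<lbrakk>l \<in> L; u \<in> l; v \<in> l; u \<noteq> v\<rbrakk> \<Longrightarrow> u \<sim> v"
  by (auto simp: pls_collinear_def)

lemma colE:
  assumes "x \<sim> y"
  obtains l where "l \<in> L" "x \<in> l" "y \<in> l" "x \<noteq> y"
  using assms by (auto simp: pls_collinear_def)

lemma line_avoid:
  assumes "l \<in> L"
  obtains z where "z \<in> l" "z \<noteq> a" "z \<noteq> b" "z \<noteq> c"
  using has_at_least_4_avoid line_size assms by metis

section \<open>Transversal planes and the traces of perps on them\<close>

lemma tp_line:
  assumes "transversal_plane P L \<pi>" "l \<in> L" "u \<in> \<pi>" "v \<in> \<pi>" "u \<in> l" "v \<in> l" "u \<noteq> v"
  shows "l \<subseteq> \<pi>"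
proof -
  have "has_at_least 2 (l \<inter> \<pi>)"
    by (rule has_at_least_2I[of u _ v]) (use assms in auto)
  then show ?thesis
    using assms
    by (auto simp: transversal_plane_def transversal_subspace_def pls_subspace_def)
qed

lemma tp_points: "transversal_plane P L \<pi> \<Longrightarrow> u \<in> \<pi> \<Longrightarrow> u \<in> P"
  by (auto simp: transversal_plane_def transversal_subspace_def pls_subspace_def)

lemma tp_partition:
  assumes "transversal_plane P L \<pi>" "l \<in> L" "l \<subseteq> \<pi>"
  shows "partition_on \<pi> ((\<lambda>x. perp P (orth L) {x} \<inter> \<pi>) ` l)"
  using assms by (auto simp: transversal_plane_def transversal_subspace_def)

lemma tp_ex:
  assumes "transversal_plane P L \<pi>" "l \<in> L" "l \<subseteq> \<pi>" "e \<in> \<pi>"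
  obtains u where "u \<in> l" "e \<bottom> u"
proof -
  have "e \<in> \<Union> ((\<lambda>x. perp P (orth L) {x} \<inter> \<pi>) ` l)"
    using partition_onD1[OF tp_partition[OF assms(1-3)]] assms(4) by simp
  then show ?thesis
    using that by (auto simp: perp_iff)
qed

lemma tp_uniq:
  assumes "transversal_plane P L \<pi>" "l \<in> L" "l \<subseteq> \<pi>" "e \<in> \<pi>" "u \<in> l" "v \<in> l"
    "e \<bottom> u" "e \<bottom> v"
  shows "u = v"
proof (rule ccontr)
  assume "u \<noteq> v"
  have P: "u \<in> P" "e \<in> P"
    using assms line_points tp_points by auto
  let ?f = "\<lambda>x. perp P (orth L) {x} \<inter> \<pi>"
  have "u \<sim> v"
    using line_col[OF assms(2,5,6) \<open>u \<noteq> v\<close>] .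
  then have "u \<in> ?f u" "u \<notin> ?f v"
    using P assms by (auto simp: perp_iff orth_iff)
  then have "?f u \<noteq> ?f v"
    by blast
  then have "?f u \<inter> ?f v = {}"
    using partition_onD2[OF tp_partition[OF assms(1-3)]] assms(5,6)
    by (auto simp: disjoint_def)
  moreover have "e \<in> ?f u" "e \<in> ?f v"
    using assms P by (auto simp: perp_iff)
  ultimately show False
    by blast
qed

text \<open>If \<open>u \<sim> v\<close>, the line joining them carries two points perpendicular to
  \<open>e\<close>, against \<open>tp_uniq\<close>. Thus \<bottom> is an equivalence relation on a
  transversal plane, with the transversals as its classes.\<close>

lemma tp_trans:
  assumes "transversal_plane P L \<pi>" "e \<in> \<pi>" "u \<in> \<pi>" "v \<in> \<pi>" "e \<bottom> u" "e \<bottom> v"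
  shows "u \<bottom> v"
proof (rule ccontr)
  assume "\<not> ?thesis"
  then obtain l where l: "l \<in> L" "u \<in> l" "v \<in> l" "u \<noteq> v"
    using orth_iff colE by metis
  then have "l \<subseteq> \<pi>"
    using tp_line assms by metis
  then show False
    using tp_uniq[OF assms(1) l(1)] l assms by metis
qed

lemma plane_through:
  assumes "x \<in> P" "y \<in> P" "z \<in> P" "x \<sim> y" "y \<sim> z" "x \<bottom> z" "x \<noteq> z"
  obtains \<pi> where "transversal_plane P L \<pi>" "x \<in> \<pi>" "y \<in> \<pi>" "z \<in> \<pi>"
proof -
  have "x \<noteq> y" "y \<noteq> z"
    using assms by (auto simp: pls_collinear_def)
  then have "transversal_plane P L (generated P L {x, y, z})"
    using planes assms by blast
  moreover have "{x, y, z} \<subseteq> generated P L {x, y, z}"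
    by (auto simp: generated_def)
  ultimately show ?thesis
    using that by blast
qed

text \<open>A perp meeting a transversal plane in two points of the same transversal can only be one of
  the last two alternatives in hypothesis (d).\<close>

lemma perp_transversal_cases:
  assumes "transversal_plane P L \<pi>" "x \<in> P" "u \<in> \<pi>" "v \<in> \<pi>" "u \<noteq> v" "u \<bottom> v"
    "x \<bottom> u" "x \<bottom> v"
  shows "(\<exists>e\<in>\<pi>. perp P (orth L) {x} \<inter> \<pi> = perp P (orth L) {e} \<inter> \<pi>)
       \<or> perp P (orth L) {x} \<inter> \<pi> = \<pi>"
proof -
  let ?S = "perp P (orth L) {x} \<inter> \<pi>"
  have uv: "u \<in> ?S" "v \<in> ?S"
    using assms tp_points orth_sym by (auto simp: perp_iff)
  have "?S \<notin> L"
    using line_col[of ?S u v] uv assms orth_iff by blast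
  moreover have "?S \<noteq> {}" "\<not> (\<exists>p\<in>P. ?S = {p})"
    using uv assms(5) by (blast, metis singletonD)
  ultimately have "?S \<in> transversals P L \<pi> \<or> ?S = \<pi>"
    using plane_perp assms(1,2) unfolding Let_def by meson
  then show ?thesis
    by (auto simp: transversals_def)
qed

text \<open>If the trace of \<open>x\<close>-perp on the plane is the transversal of some
  \<open>e\<close>, it shares the point \<open>u\<close> with the transversal of \<open>u\<close>,
  so by \<open>tp_trans\<close> the two coincide and \<open>w\<close> belongs to the trace.\<close>

lemma perp_transversal:
  assumes "transversal_plane P L \<pi>" "x \<in> P" "u \<in> \<pi>" "v \<in> \<pi>" "w \<in> \<pi>" "u \<noteq> v" "u \<bottom> v"
    "u \<bottom> w" "x \<bottom> u" "x \<bottom> v"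
  shows "x \<bottom> w"
  using perp_transversal_cases[OF assms(1-4,6,7,9,10)]
proof
  assume "\<exists>e\<in>\<pi>. perp P (orth L) {x} \<inter> \<pi> = perp P (orth L) {e} \<inter> \<pi>"
  then obtain e where e: "e \<in> \<pi>" "perp P (orth L) {x} \<inter> \<pi> = perp P (orth L) {e} \<inter> \<pi>"
    by blast
  have "u \<in> perp P (orth L) {x} \<inter> \<pi>"
    using assms tp_points orth_sym by (auto simp: perp_iff)
  then have "u \<bottom> e"
    using e by (auto simp: perp_iff)
  then have "w \<bottom> e"
    using tp_trans[OF assms(1,3) _ e(1)] assms by blast
  then have "w \<in> perp P (orth L) {x} \<inter> \<pi>"
    using e assms tp_points by (auto simp: perp_iff)
  then show ?thesis
    using orth_sym by (auto simp: perp_iff)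
next
  assume "perp P (orth L) {x} \<inter> \<pi> = \<pi>"
  then have "w \<in> perp P (orth L) {x}"
    using assms by blast
  then show ?thesis
    using orth_sym by (auto simp: perp_iff)
qed

text \<open>The points \<open>u\<close> and \<open>c\<close> lie in different transversals, so the
  trace of \<open>x\<close>-perp cannot be a single transversal and has to be the whole
  plane.\<close>

lemma perp_whole_plane:
  assumes "transversal_plane P L \<pi>" "x \<in> P" "u \<in> \<pi>" "v \<in> \<pi>" "c \<in> \<pi>" "w \<in> \<pi>" "u \<noteq> v"
    "u \<bottom> v" "u \<sim> c" "x \<bottom> u" "x \<bottom> v" "x \<bottom> c"
  shows "x \<bottom> w"
  using perp_transversal_cases[OF assms(1-4,7,8,10,11)]
proof
  assume "\<exists>e\<in>\<pi>. perp P (orth L) {x} \<inter> \<pi> = perp P (orth L) {e} \<inter> \<pi>"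
  then obtain e where e: "e \<in> \<pi>" "perp P (orth L) {x} \<inter> \<pi> = perp P (orth L) {e} \<inter> \<pi>"
    by blast
  have "u \<in> perp P (orth L) {x} \<inter> \<pi>" "c \<in> perp P (orth L) {x} \<inter> \<pi>"
    using assms tp_points orth_sym by (auto simp: perp_iff)
  then have "e \<bottom> u" "e \<bottom> c"
    using e orth_sym by (auto simp: perp_iff)
  then have "u \<bottom> c"
    using tp_trans[OF assms(1) e(1)] assms by blast
  then show ?thesis
    using assms orth_iff by blast
next
  assume "perp P (orth L) {x} \<inter> \<pi> = \<pi>"
  then have "w \<in> perp P (orth L) {x}"
    using assms by blast
  then show ?thesis
    using orth_sym by (auto simp: perp_iff)
qed

section \<open>Perps of lines and the collinearity graph\<close>

text \<open>If \<open>x \<sim> w\<close>, then \<open>x\<close>, \<open>w\<close>, \<open>u\<close>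
  generate a transversal plane containing \<open>l\<close>, in which \<open>x\<close> is
  perpendicular to only one point of \<open>l\<close>. Hence lines have the closure property that
  \<open>perp_transversal\<close> gives for transversals.\<close>

lemma perp_line:
  assumes "x \<in> P" "l \<in> L" "u \<in> l" "v \<in> l" "w \<in> l" "u \<noteq> v" "x \<bottom> u" "x \<bottom> v"
  shows "x \<bottom> w"
proof (rule ccontr)
  assume "\<not> ?thesis"
  then have xw: "x \<sim> w"
    by (simp add: orth_iff)
  have "w \<noteq> u" "x \<noteq> u"
    using xw assms line_col orth_iff by metis+
  then have "w \<sim> u"
    using line_col assms by metis
  then obtain \<pi> where \<pi>: "transversal_plane P L \<pi>" "x \<in> \<pi>" "w \<in> \<pi>" "u \<in> \<pi>"
    using plane_through[OF assms(1) _ _ xw] assms line_points \<open>x \<noteq> u\<close> by metis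
  then have "l \<subseteq> \<pi>"
    using tp_line assms \<open>w \<noteq> u\<close> by metis
  then show False
    using tp_uniq[OF \<pi>(1) assms(2) _ \<pi>(2) assms(3,4)] assms by blast
qed

text \<open>A path \<open>x\<close>, \<open>y\<close>, \<open>w\<close>, \<open>z\<close> with
  \<open>x \<bottom> w\<close> is shortened with a third point \<open>y'\<close> of the line on
  \<open>y\<close> and \<open>w\<close>. On that line \<open>w\<close> is the only point
  perpendicular to \<open>x\<close>, and \<open>z\<close>, being collinear to \<open>w\<close>, is
  perpendicular to at most one point, so \<open>y\<close> or \<open>y'\<close> is collinear to both
  ends.\<close>

lemma col_diameter_2:
  assumes "x \<in> P" "z \<in> P" "x \<bottom> z" "x \<noteq> z"
  obtains y where "y \<in> P" "x \<sim> y" "y \<sim> z"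
proof -
  have "(\<lambda>u v. u \<in> P \<and> v \<in> P \<and> u \<sim> v)\<^sup>*\<^sup>* x z"
    using connected assms by (simp add: connected_graph_def)
  then have "x = z \<or> x \<sim> z \<or> (\<exists>y\<in>P. x \<sim> y \<and> y \<sim> z)"
  proof induction
    case base
    then show ?case by simp
  next
    case (step w z)
    then have wz: "w \<in> P" "z \<in> P" "w \<sim> z"
      by auto
    consider "x = w" | "x \<sim> w" | y where "y \<in> P" "x \<sim> y" "y \<sim> w" "x \<bottom> w"
      using step.IH orth_iff by metis
    then show ?case
    proof cases
      case 3
      obtain l where l: "l \<in> L" "y \<in> l" "w \<in> l" "y \<noteq> w"
        using 3 colE by metis
      obtain y' where y': "y' \<in> l" "y' \<noteq> y" "y' \<noteq> w"
        using line_avoid[OF l(1)] by metis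
      have "x \<sim> y'"
        using perp_line[OF assms(1) l(1,3) y'(1) l(2)] 3 y'(3) orth_iff by metis
      moreover have "z \<sim> y \<or> z \<sim> y'"
        using perp_line[OF wz(2) l(1,2) y'(1) l(3)] y'(2) wz(3) orth_iff col_sym by metis
      ultimately show ?thesis
        using 3 col_sym line_points[OF l(1) y'(1)] by blast
    qed (use wz in auto)
  qed
  then show ?thesis
    using that assms orth_iff by blast
qed

text \<open>For collinear points \<open>e\<close> is a third point of their line, otherwise a third
  point of their transversal in a transversal plane. Treating both cases alike is what the covering
  argument in \<open>perp_pair_not_subset\<close> needs.\<close>

lemma third_point:
  assumes "x \<in> P" "z \<in> P" "x \<noteq> z"
  obtains e where "e \<in> P"
    "\<And>q. q \<in> P \<Longrightarrow> q \<bottom> x \<Longrightarrow> q \<bottom> z \<Longrightarrow> q \<bottom> e"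
    "\<And>q. q \<in> P \<Longrightarrow> q \<bottom> x \<Longrightarrow> q \<bottom> e \<Longrightarrow> q \<bottom> z"
    "\<And>q. q \<in> P \<Longrightarrow> q \<bottom> z \<Longrightarrow> q \<bottom> e \<Longrightarrow> q \<bottom> x"
proof (cases "x \<sim> z")
  case True
  then obtain l where l: "l \<in> L" "x \<in> l" "z \<in> l"
    using colE by metis
  obtain e where e: "e \<in> l" "e \<noteq> x" "e \<noteq> z"
    using line_avoid[OF l(1)] by metis
  show ?thesis
  proof (rule that[of e])
    show "e \<in> P"
      using line_points l e by blast
  qed (use perp_line[OF _ l(1)] l e assms in metis)+
next
  case False
  then have xz: "x \<bottom> z"
    by (simp add: orth_iff)
  obtain y where y: "y \<in> P" "x \<sim> y" "y \<sim> z"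
    using col_diameter_2 assms xz by metis
  obtain \<pi> where \<pi>: "transversal_plane P L \<pi>" "x \<in> \<pi>" "y \<in> \<pi>" "z \<in> \<pi>"
    using plane_through[OF assms(1) y(1) assms(2) y(2,3) xz assms(3)] .
  obtain l where l: "l \<in> L" "x \<in> l" "y \<in> l" "x \<noteq> y"
    using colE y by metis
  obtain m where m: "m \<in> L" "y \<in> m" "z \<in> m" "y \<noteq> z"
    using colE y by metis
  have lm: "l \<noteq> m"
    using False l m assms line_col by metis
  have l\<pi>: "l \<subseteq> \<pi>" and m\<pi>: "m \<subseteq> \<pi>"
    using tp_line \<pi> l m by metis+
  obtain a where a: "a \<in> l" "a \<noteq> x" "a \<noteq> y"
    using line_avoid[OF l(1)] by metis
  obtain c where c: "c \<in> m" "a \<bottom> c"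
    using tp_ex[OF \<pi>(1) m(1) m\<pi>, of a] a l\<pi> by blast
  \<comment> \<open>Avoiding \<open>c\<close>, the only point of \<open>m\<close> perpendicular to
    \<open>a\<close>, gives \<open>a \<sim> b\<close>. The line \<open>n\<close> on \<open>a\<close>
    and \<open>b\<close> contains neither \<open>x\<close> nor \<open>z\<close>, so it meets the
    transversal of \<open>x\<close> in a third point \<open>e\<close>.\<close>
  obtain b where b: "b \<in> m" "b \<noteq> y" "b \<noteq> z" "b \<noteq> c"
    using line_avoid[OF m(1)] by metis
  have "a \<sim> b"
    using tp_uniq[OF \<pi>(1) m(1) m\<pi>, of a b c] a l\<pi> b c orth_iff by blast
  then obtain n where n: "n \<in> L" "a \<in> n" "b \<in> n" "a \<noteq> b"
    using colE by metis
  have "n \<subseteq> \<pi>"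
    using tp_line[OF \<pi>(1) n(1)] n a b l\<pi> m\<pi> by blast
  then obtain e where e: "e \<in> n" "x \<bottom> e" "e \<in> \<pi>"
    using tp_ex[OF \<pi>(1) n(1) _ \<pi>(2)] by blast
  have "n \<noteq> l"
    using line_unique[OF l(1) m(1), of b y] l m b n lm by blast
  then have "e \<noteq> x"
    using line_unique[OF n(1) l(1), of x a] e n l a by blast
  have "n \<noteq> m"
    using line_unique[OF l(1) m(1), of a y] l m a n lm by blast
  then have "e \<noteq> z"
    using line_unique[OF n(1) m(1), of z b] e n m b by blast
  have ze: "z \<bottom> e"
    using tp_trans[OF \<pi>(1,2)] \<pi> e xz by blast
  note pt = perp_transversal[OF \<pi>(1)]
  show ?thesis
  proof (rule that[of e])
    show "e \<in> P"
      using tp_points \<pi> e by blast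
    show "q \<bottom> e" if "q \<in> P" "q \<bottom> x" "q \<bottom> z" for q
      by (rule pt[of q x z e]) (use that \<pi> e xz assms in auto)
    show "q \<bottom> z" if "q \<in> P" "q \<bottom> x" "q \<bottom> e" for q
      by (rule pt[of q x e z]) (use that \<pi> e xz \<open>e \<noteq> x\<close> in auto)
    show "q \<bottom> x" if "q \<in> P" "q \<bottom> z" "q \<bottom> e" for q
      by (rule pt[of q z e x]) (use that \<pi> e ze orth_sym[OF xz] \<open>e \<noteq> z\<close> in auto)
  qed
qed

section \<open>The swap construction\<close>

text \<open>The relation \<open>r \<sim> q\<close> is what lets the roles of \<open>s\<close> and \<open>t\<close> be exchanged in
  \<open>perp_swap_sym\<close>.\<close>

lemma perp_swap_core:
  assumes P: "p \<in> P" "s \<in> P" "t \<in> P" "q \<in> P"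
    and ps: "p \<sim> s" and pt: "p \<sim> t" and st: "s \<bottom> t" "s \<noteq> t"
    and qp: "q \<bottom> p" and qs: "q \<bottom> s" and qt: "q \<sim> t"
  obtains r where "r \<in> P" "r \<bottom> p" "r \<sim> q"
    "\<And>e. e \<in> P \<Longrightarrow> e \<bottom> t \<and> e \<bottom> r \<longleftrightarrow> e \<bottom> s \<and> e \<bottom> t"
proof -
  obtain \<pi> where \<pi>: "transversal_plane P L \<pi>" "s \<in> \<pi>" "p \<in> \<pi>" "t \<in> \<pi>"
    using plane_through[OF P(2,1,3) col_sym[OF ps] pt st] .
  obtain l1 where l1: "l1 \<in> L" "p \<in> l1" "t \<in> l1" "p \<noteq> t"
    using colE[OF pt] .
  have l1\<pi>: "l1 \<subseteq> \<pi>"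
    using tp_line[OF \<pi>(1) l1(1) \<pi>(3,4) l1(2,3,4)] .
  have sl1: "s \<notin> l1"
    using line_col[OF l1(1), of s t] l1(3) st orth_iff by blast
  obtain a where a: "a \<in> l1" "a \<noteq> p" "a \<noteq> t"
    using line_avoid[OF l1(1)] by metis
  have aP: "a \<in> P" and a\<pi>: "a \<in> \<pi>"
    using a l1 l1\<pi> line_points by auto
  have "\<not> s \<bottom> a"
    using perp_line[OF P(2) l1(1,3) a(1) l1(2)] a(3) st(1) col_sym[OF ps] orth_iff by blast
  then have as: "a \<sim> s"
    using orth_iff col_sym by blast
  obtain n where n: "n \<in> L" "a \<in> n" "s \<in> n" "a \<noteq> s"
    using colE[OF as] .
  have n\<pi>: "n \<subseteq> \<pi>"
    using tp_line[OF \<pi>(1) n(1) a\<pi> \<pi>(2) n(2,3,4)] .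
  have l1n: "l1 \<noteq> n"
    using sl1 n by blast
  obtain c0 where c0: "c0 \<in> n" "p \<bottom> c0"
    using tp_ex[OF \<pi>(1) n(1) n\<pi> \<pi>(3)] .
  \<comment> \<open>\<open>c0\<close> is excluded to get \<open>p \<sim> b\<close>, which provides a
    second line \<open>l2\<close> of the plane through \<open>p\<close>.\<close>
  obtain b where b: "b \<in> n" "b \<noteq> a" "b \<noteq> s" "b \<noteq> c0"
    using line_avoid[OF n(1)] .
  have bP: "b \<in> P" and b\<pi>: "b \<in> \<pi>"
    using b n n\<pi> line_points by auto
  have pb: "p \<sim> b"
    using tp_uniq[OF \<pi>(1) n(1) n\<pi> \<pi>(3) c0(1) b(1) c0(2)] b(4) orth_iff by blast
  obtain l2 where l2: "l2 \<in> L" "p \<in> l2" "b \<in> l2" "p \<noteq> b"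
    using colE[OF pb] .
  have l2\<pi>: "l2 \<subseteq> \<pi>"
    using tp_line[OF \<pi>(1) l2(1) \<pi>(3) b\<pi> l2(2,3,4)] .
  have l1l2: "l1 \<noteq> l2"
    using line_unique[OF l1(1) n(1) a(1) _ n(2) b(1)] l2(3) b(2) l1n by blast
  have pn: "p \<notin> n"
    using line_unique[OF l1(1) n(1) a(1) l1(2) n(2)] a(2) l1n by blast
  have ab: "a \<sim> b" and bs: "b \<sim> s"
    using line_col[OF n(1)] n b by metis+
  \<comment> \<open>A third point of the transversal on \<open>s\<close> and \<open>t\<close>,
    collinear to \<open>p\<close> along \<open>l2\<close>. It is also collinear to \<open>q\<close>,
    since \<open>q\<close> is perpendicular to \<open>s\<close> but not to \<open>t\<close>.\<close>
  obtain t2 where t2: "t2 \<in> l2" "t \<bottom> t2"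
    using tp_ex[OF \<pi>(1) l2(1) l2\<pi> \<pi>(4)] .
  have t2P: "t2 \<in> P" and t2\<pi>: "t2 \<in> \<pi>"
    using t2 l2 l2\<pi> line_points by auto
  have st2: "s \<bottom> t2"
    using tp_trans[OF \<pi>(1,4,2) t2\<pi> orth_sym[OF st(1)] t2(2)] .
  have t2t: "t2 \<noteq> t"
    using line_unique[OF l1(1) l2(1) l1(2,3) l2(2)] t2(1) l1(4) l1l2 by blast
  have t2s: "t2 \<noteq> s"
    using line_unique[OF l2(1) n(1) l2(3) _ b(1) n(3) b(3)] t2(1) l2(2) pn by blast
  have pt2: "p \<sim> t2"
    using line_col[OF l2(1,2) t2(1)] pt t2(2) orth_iff col_sym by metis
  have t2b: "t2 \<noteq> b"
    using st2 bs orth_iff orth_sym by blast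
  have bt2: "b \<sim> t2"
    using line_col[OF l2(1,3) t2(1)] t2b by metis
  have at: "a \<sim> t"
    using line_col[OF l1(1) a(1) l1(3) a(3)] .
  have "\<not> q \<bottom> t2"
    using perp_transversal[OF \<pi>(1) P(4) \<pi>(2) t2\<pi> \<pi>(4) t2s[symmetric] st2 st(1) qs]
      qt orth_iff by blast
  then have qt2: "q \<sim> t2"
    by (simp add: orth_iff)
  have pq: "p \<bottom> q"
    using orth_sym[OF qp] .
  have p_ne_q: "p \<noteq> q"
    using ps qs orth_iff by blast
  obtain m1 where m1: "m1 \<in> L" "q \<in> m1" "t \<in> m1" "q \<noteq> t"
    using colE[OF qt] .
  obtain m2 where m2: "m2 \<in> L" "q \<in> m2" "t2 \<in> m2" "q \<noteq> t2"
    using colE[OF qt2] .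
  obtain \<sigma> where \<sigma>: "transversal_plane P L \<sigma>" "p \<in> \<sigma>" "t \<in> \<sigma>" "q \<in> \<sigma>"
    using plane_through[OF P(1,3,4) pt col_sym[OF qt] pq p_ne_q] .
  have l1\<sigma>: "l1 \<subseteq> \<sigma>" and m1\<sigma>: "m1 \<subseteq> \<sigma>"
    using tp_line[OF \<sigma>(1)] l1 m1 \<sigma> by metis+
  obtain \<tau> where \<tau>: "transversal_plane P L \<tau>" "p \<in> \<tau>" "t2 \<in> \<tau>" "q \<in> \<tau>"
    using plane_through[OF P(1) t2P P(4) pt2 col_sym[OF qt2] pq p_ne_q] .
  have p_ne_t2: "p \<noteq> t2"
    using pt2 orth_iff orth_refl by metis
  have l2\<tau>: "l2 \<subseteq> \<tau>" and m2\<tau>: "m2 \<subseteq> \<tau>"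
    using tp_line[OF \<tau>(1)] l2 m2 \<tau> t2 p_ne_t2 by metis+
  \<comment> \<open>Both \<open>v\<close> and the later \<open>v'\<close> are perpendicular to the
    whole line \<open>n\<close>: to \<open>a\<close> or \<open>b\<close> by choice, and to
    \<open>s\<close> because \<open>s\<close> is perpendicular to \<open>q\<close>,
    \<open>t\<close>, \<open>t2\<close> and hence to \<open>m1\<close> and
    \<open>m2\<close>.\<close>
  obtain v where v: "v \<in> m1" "a \<bottom> v"
    using tp_ex[OF \<sigma>(1) m1(1) m1\<sigma>, of a] a(1) l1\<sigma> by blast
  have vP: "v \<in> P"
    using line_points[OF m1(1) v(1)] .
  have "s \<bottom> v"
    using perp_line[OF P(2) m1(1,2,3) v(1) m1(4) orth_sym[OF qs] st(1)] .
  then have vb: "v \<bottom> b"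
    using perp_line[OF vP n(1,2,3) b(1) n(4)] v(2) orth_sym by blast
  obtain v' where v': "v' \<in> m2" "b \<bottom> v'"
    using tp_ex[OF \<tau>(1) m2(1) m2\<tau>, of b] l2(3) l2\<tau> by blast
  have v'P: "v' \<in> P"
    using line_points[OF m2(1) v'(1)] .
  have "s \<bottom> v'"
    using perp_line[OF P(2) m2(1,2,3) v'(1) m2(4) orth_sym[OF qs] st2] .
  then have v'a: "v' \<bottom> a"
    using perp_line[OF v'P n(1) b(1) n(3) n(2) b(3)] v'(2) orth_sym by blast
  have vt: "v \<noteq> t"
    using at v(2) orth_iff by blast
  have "\<not> q \<bottom> b"
    using perp_line[OF P(4) l2(1,2,3) t2(1) l2(4) qp] qt2 orth_iff by blast
  then have bq: "b \<sim> q"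
    using orth_iff col_sym by blast
  have v't2: "v' \<noteq> t2"
    using bt2 v'(2) orth_iff by blast
  have v'q: "v' \<noteq> q"
    using bq v'(2) orth_iff by blast
  have t2v: "t2 \<sim> v"
    using perp_line[OF t2P m1(1,3) v(1) m1(2)] t2(2) vt qt2 orth_iff orth_sym by metis
  \<comment> \<open>Otherwise a line of \<open>\<tau>\<close> perpendicular to \<open>a\<close> yields \<open>c \<bottom> v\<close>, and together with \<open>b\<close> and
    \<open>v'\<close> this makes \<open>v\<close> perpendicular to the whole of \<open>\<tau>\<close>.\<close>
  have vv': "v \<sim> v'"
  proof (rule ccontr)
    assume "\<not> ?thesis"
    then have vv': "v \<bottom> v'"
      by (simp add: orth_iff)
    have v'\<tau>: "v' \<in> \<tau>" and b\<tau>: "b \<in> \<tau>"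
      using v'(1) m2\<tau> l2(3) l2\<tau> by auto
    obtain b' where b': "b' \<in> l2" "a \<bottom> b'"
      using tp_ex[OF \<pi>(1) l2(1) l2\<pi> a\<pi>] .
    have b'b: "b' \<noteq> b"
      using ab b' orth_iff by blast
    have "\<not> v' \<bottom> b'"
      using tp_uniq[OF \<tau>(1) l2(1) l2\<tau> v'\<tau> b'(1) l2(3) _ orth_sym[OF v'(2)]] b'b by blast
    then have "b' \<sim> v'"
      using orth_iff col_sym by blast
    then obtain k where k: "k \<in> L" "b' \<in> k" "v' \<in> k" "b' \<noteq> v'"
      by (rule colE)
    have k\<tau>: "k \<subseteq> \<tau>"
      using tp_line[OF \<tau>(1) k(1) _ v'\<tau> k(2,3,4)] b'(1) l2\<tau> by blast
    obtain c where c: "c \<in> k" "p \<bottom> c"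
      using tp_ex[OF \<tau>(1) k(1) k\<tau> \<tau>(2)] .
    have cP: "c \<in> P" and c\<tau>: "c \<in> \<tau>"
      using c(1) k(1) k\<tau> line_points by auto
    have ca: "c \<bottom> a"
      using perp_line[OF aP k(1,2,3) c(1) k(4) b'(2) orth_sym[OF v'a]] orth_sym by blast
    have "c \<bottom> t"
      using perp_line[OF cP l1(1) a(1) l1(2,3) a(2) ca orth_sym[OF c(2)]] .
    moreover have "c \<bottom> q"
      using tp_trans[OF \<tau>(1,2) c\<tau> \<tau>(4) c(2) pq] .
    ultimately have cv: "c \<bottom> v"
      using perp_line[OF cP m1(1,2,3) v(1) m1(4)] by blast
    have "\<not> c \<bottom> b"
      using tp_uniq[OF \<tau>(1) l2(1) l2\<tau> c\<tau> l2(2,3) orth_sym[OF c(2)]] l2(4) by blast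
    then have bc: "b \<sim> c"
      using orth_iff col_sym by blast
    have "p \<notin> m2"
      using line_col[OF m2(1) _ m2(2)] p_ne_q pq orth_iff by blast
    then have bv': "b \<noteq> v'"
      using line_unique[OF l2(1) m2(1) l2(3) t2(1) _ m2(3)] v'(1) t2b l2(2) by blast
    have "v \<bottom> t2"
      using perp_whole_plane[OF \<tau>(1) vP b\<tau> v'\<tau> c\<tau> \<tau>(3) bv' v'(2) bc vb vv' orth_sym[OF cv]] .
    then show False
      using t2v orth_iff orth_sym by blast
  qed
  \<comment> \<open>The points \<open>t\<close>, \<open>t2\<close>, \<open>r\<close> lie on a
    transversal of \<open>\<rho>\<close>, and \<open>s\<close>, \<open>t\<close>, \<open>t2\<close>
    on one of \<open>\<pi>\<close>, so {t,r}^perp = {t,t2}^perp = {s,t}^perp. As a point of the line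
    \<open>k\<close> on \<open>v\<close> and \<open>v'\<close>, \<open>r\<close> is perpendicular to
    \<open>a\<close>; with \<open>t \<bottom> r\<close> this gives
    \<open>r \<bottom> p\<close>.\<close>
  obtain \<rho> where \<rho>: "transversal_plane P L \<rho>" "t \<in> \<rho>" "q \<in> \<rho>" "t2 \<in> \<rho>"
    using plane_through[OF P(3,4) t2P col_sym[OF qt] qt2 t2(2) t2t[symmetric]] .
  have m1\<rho>: "m1 \<subseteq> \<rho>" and m2\<rho>: "m2 \<subseteq> \<rho>"
    using tp_line[OF \<rho>(1)] m1 m2 \<rho> by metis+
  obtain k where k: "k \<in> L" "v \<in> k" "v' \<in> k" "v \<noteq> v'"
    using colE[OF vv'] .
  have k\<rho>: "k \<subseteq> \<rho>"
    using tp_line[OF \<rho>(1) k(1) _ _ k(2,3,4)] v(1) v'(1) m1\<rho> m2\<rho> by blast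
  obtain r where r: "r \<in> k" "t \<bottom> r"
    using tp_ex[OF \<rho>(1) k(1) k\<rho> \<rho>(2)] .
  have rP: "r \<in> P" and r\<rho>: "r \<in> \<rho>"
    using r(1) k(1) k\<rho> line_points by auto
  have ar: "a \<bottom> r"
    using perp_line[OF aP k(1,2,3) r(1) k(4) v(2) orth_sym[OF v'a]] .
  have rp: "r \<bottom> p"
    using perp_line[OF rP l1(1) a(1) l1(3,2) a(3) orth_sym[OF ar] orth_sym[OF r(2)]] .
  have rt: "r \<noteq> t"
    using ar at orth_iff by blast
  have "\<not> r \<bottom> q"
    using tp_trans[OF \<rho>(1) r\<rho> \<rho>(2,3) orth_sym[OF r(2)]] qt orth_iff orth_sym by blast
  then have rq: "r \<sim> q"
    by (simp add: orth_iff)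
  show ?thesis
  proof (rule that[OF rP rp rq])
    fix e
    assume e: "e \<in> P"
    have "e \<bottom> s" if "e \<bottom> t" "e \<bottom> r"
    proof -
      have "e \<bottom> t2"
        using perp_transversal[OF \<rho>(1) e \<rho>(2) r\<rho> \<rho>(4) rt[symmetric] r(2) t2(2) that] .
      then show ?thesis
        using perp_transversal[OF \<pi>(1) e \<pi>(4) t2\<pi> \<pi>(2) t2t[symmetric] t2(2)
            orth_sym[OF st(1)] that(1)] by blast
    qed
    moreover have "e \<bottom> r" if "e \<bottom> s" "e \<bottom> t"
    proof -
      have "e \<bottom> t2"
        using perp_transversal[OF \<pi>(1) e \<pi>(2,4) t2\<pi> st(2,1) st2 that] .
      then show ?thesis
        using perp_transversal[OF \<rho>(1) e \<rho>(2,4) r\<rho> t2t[symmetric] t2(2) r(2) that(2)] by blast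
    qed
    ultimately show "e \<bottom> t \<and> e \<bottom> r \<longleftrightarrow> e \<bottom> s \<and> e \<bottom> t"
      by blast
  qed
qed

section \<open>Existence of the points needed for swapping\<close>

text \<open>Along a path for \<bottom>, a common perpendicular \<open>q\<close> of \<open>p\<close>
  and \<open>s\<close> is carried over to the next vertex \<open>t\<close>. If none of
  \<open>p\<close>, \<open>s\<close>, \<open>q\<close> serves for \<open>p\<close> and
  \<open>t\<close>, the swapped point \<open>r\<close> does: \<open>t\<close> lies in {s,t}^perp =
  {t,r}^perp.\<close>

lemma perp_diameter_2:
  assumes "p \<in> P" "t \<in> P"
  obtains w where "w \<in> P" "w \<bottom> p" "w \<bottom> t"
proof -
  have "(\<lambda>u v. u \<in> P \<and> v \<in> P \<and> u \<bottom> v)\<^sup>*\<^sup>* p t"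
    using coconnected assms by (simp add: connected_graph_def)
  then have "\<exists>w\<in>P. w \<bottom> p \<and> w \<bottom> t"
  proof induction
    case base
    then show ?case
      using assms(1) orth_refl by blast
  next
    case (step s t)
    then have st: "s \<in> P" "t \<in> P" "s \<bottom> t"
      by auto
    obtain q where q: "q \<in> P" "q \<bottom> p" "q \<bottom> s"
      using step.IH by blast
    consider "p \<bottom> t" | "p \<bottom> s" | "s = t" | "q \<bottom> t"
      | "p \<sim> s" "p \<sim> t" "s \<noteq> t" "q \<sim> t"
      using orth_iff by blast
    then show ?case
    proof cases
      case 5
      obtain r where r: "r \<in> P" "r \<bottom> p" "r \<sim> q"
        "\<And>e. e \<in> P \<Longrightarrow> e \<bottom> t \<and> e \<bottom> r \<longleftrightarrow> e \<bottom> s \<and> e \<bottom> t"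
        using perp_swap_core[OF assms(1) st(1,2) q(1) 5(1,2) st(3) 5(3) q(2,3) 5(4)] by blast
      have "t \<bottom> r"
        using r(4)[OF st(2)] orth_sym[OF st(3)] orth_refl by blast
      then show ?thesis
        using r(1,2) orth_sym by blast
    qed (use assms st q orth_sym orth_refl in blast)+
  qed
  then show ?thesis
    using that by blast
qed

text \<open>A first use of \<open>perp_swap_core\<close>, with \<open>t\<close>, \<open>q\<close>,
  \<open>p\<close>, \<open>s\<close> in the places of \<open>p\<close>, \<open>s\<close>,
  \<open>t\<close>, \<open>q\<close>, yields \<open>q'\<close> perpendicular to \<open>p\<close> and
  \<open>t\<close> but collinear to \<open>s\<close>. With \<open>q'\<close> the construction runs
  again, \<open>s\<close> and \<open>t\<close> exchanged.\<close>

lemma perp_swap_sym: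
  assumes P: "p \<in> P" "s \<in> P" "t \<in> P" "q \<in> P"
    and ps: "p \<sim> s" and pt: "p \<sim> t" and st: "s \<bottom> t" "s \<noteq> t"
    and q: "q \<bottom> p" "q \<bottom> s" "q \<sim> t"
  obtains r where "r \<in> P" "r \<bottom> p"
    "\<And>e. e \<in> P \<Longrightarrow> e \<bottom> s \<and> e \<bottom> r \<longleftrightarrow> e \<bottom> s \<and> e \<bottom> t"
proof -
  have "q \<noteq> p"
    using ps q(2) orth_iff by blast
  then obtain q' where q': "q' \<in> P" "q' \<bottom> t" "q' \<sim> s"
    "\<And>e. e \<in> P \<Longrightarrow> e \<bottom> p \<and> e \<bottom> q' \<longleftrightarrow> e \<bottom> q \<and> e \<bottom> p"
    using perp_swap_core[OF P(3,4,1,2) col_sym[OF q(3)] col_sym[OF pt] q(1) _ st(1)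
        orth_sym[OF q(2)] col_sym[OF ps]] by metis
  have "q' \<bottom> p"
    using q'(4)[OF P(1)] orth_sym[OF q(1)] orth_refl orth_sym by blast
  then obtain r where "r \<in> P" "r \<bottom> p"
    "\<And>e. e \<in> P \<Longrightarrow> e \<bottom> s \<and> e \<bottom> r \<longleftrightarrow> e \<bottom> t \<and> e \<bottom> s"
    using perp_swap_core[OF P(1,3,2) q'(1) pt ps orth_sym[OF st(1)] st(2)[symmetric] _ q'(2,3)]
    by metis
  then show ?thesis
    using that by blast
qed

lemma not_perp_subset:
  assumes "x \<in> P" "y \<in> P" "x \<noteq> y"
  obtains h where "h \<in> P" "h \<bottom> x" "h \<sim> y"
proof -
  have "\<not> perp P (orth L) {x} \<subseteq> perp P (orth L) {y}"
    using reduced assms by blast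
  then show ?thesis
    using that by (auto simp: perp_iff orth_iff)
qed

text \<open>Otherwise, for a common perpendicular \<open>w\<close> of \<open>p\<close> and
  \<open>s\<close>, \<open>K'\<close> covers \<open>s\<close>-perp by \<open>t\<close>-perp and
  \<open>w\<close>-perp. By (b) neither contains it, and \<open>third_point\<close> excludes this in
  the way a group is not the union of two proper subgroups.\<close>

lemma perp_pair_not_subset:
  assumes P: "p \<in> P" "s \<in> P" "t \<in> P"
    and ps: "p \<sim> s" and pt: "p \<sim> t" and st: "s \<bottom> t" "s \<noteq> t"
  obtains q where "q \<in> P" "q \<bottom> p" "q \<bottom> s" "q \<sim> t"
proof (rule ccontr)
  note found = that
  assume "\<not> thesis"
  have K: "q \<bottom> t" if "q \<in> P" "q \<bottom> p" "q \<bottom> s" for q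
    using found[OF that] \<open>\<not> thesis\<close> by (auto simp: orth_iff)
  \<comment> \<open>If \<open>w \<sim> h\<close>, swapping with \<open>w\<close> as witness gives
    \<open>r \<bottom> p\<close> with {s,r}^perp = {s,h}^perp. By \<open>K\<close> the former
    contains \<open>t\<close>, so \<open>t \<bottom> h\<close>.\<close>
  have K': "w \<bottom> h"
    if h: "h \<in> P" "h \<bottom> s" "h \<sim> t" and w: "w \<in> P" "w \<bottom> p" "w \<bottom> s" for h w
  proof (rule ccontr)
    assume "\<not> w \<bottom> h"
    then have wh: "w \<sim> h"
      by (simp add: orth_iff)
    have ph: "p \<sim> h"
      using K[OF h(1) _ h(2)] h(3) orth_iff orth_sym by blast
    have "s \<noteq> h"
      using st h(3) orth_iff by blast
    then obtain r where r: "r \<in> P" "r \<bottom> p"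
      "\<And>e. e \<in> P \<Longrightarrow> e \<bottom> s \<and> e \<bottom> r \<longleftrightarrow> e \<bottom> s \<and> e \<bottom> h"
      using perp_swap_sym[OF P(1,2) h(1) w(1) ps ph orth_sym[OF h(2)] _ w(2,3) wh] by blast
    have "r \<bottom> s"
      using r(3)[OF P(2)] orth_sym[OF h(2)] orth_refl orth_sym by blast
    then have "t \<bottom> r"
      using K r orth_sym by blast
    then have "t \<bottom> h"
      using r(3)[OF P(3)] orth_sym[OF st(1)] by blast
    then show False
      using h(3) orth_iff orth_sym by blast
  qed
  obtain w where w: "w \<in> P" "w \<bottom> p" "w \<bottom> s"
    using perp_diameter_2[OF P(1,2)] .
  have "s \<noteq> w"
    using ps w(2) orth_iff orth_sym by blast
  then obtain g where g: "g \<in> P" "g \<bottom> s" "g \<sim> w"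
    using not_perp_subset[OF P(2) w(1)] by blast
  have gt: "t \<bottom> g"
    using K'[OF g(1,2) _ w] g(3) orth_iff orth_sym by blast
  obtain h where h: "h \<in> P" "h \<bottom> s" "h \<sim> t"
    using not_perp_subset[OF P(2,3) st(2)] .
  have wh: "w \<bottom> h"
    using K'[OF h w] .
  have "g \<noteq> h"
    using g(3) wh orth_iff orth_sym by blast
  then obtain e where e: "e \<in> P"
    "\<And>x. x \<in> P \<Longrightarrow> x \<bottom> g \<Longrightarrow> x \<bottom> h \<Longrightarrow> x \<bottom> e"
    "\<And>x. x \<in> P \<Longrightarrow> x \<bottom> g \<Longrightarrow> x \<bottom> e \<Longrightarrow> x \<bottom> h"
    "\<And>x. x \<in> P \<Longrightarrow> x \<bottom> h \<Longrightarrow> x \<bottom> e \<Longrightarrow> x \<bottom> g"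
    using third_point[OF g(1) h(1)] by blast
  have "e \<bottom> s"
    using e(2)[OF P(2)] g(2) h(2) orth_sym by blast
  moreover have "e \<sim> t"
    using e(3)[OF P(3) gt] h(3) orth_iff orth_sym by blast
  ultimately have "w \<bottom> e"
    using K'[OF e(1) _ _ w] by blast
  then have "w \<bottom> g"
    using e(4)[OF w(1) wh] by blast
  then show False
    using g(3) orth_iff orth_sym by blast
qed

text \<open>Since \<open>r\<close> lies in {s,t}^perp^perp, this contains the existence half of the
  polar space axiom. The point \<open>q\<close> demanded by \<open>perp_swap_core\<close> is now
  always available.\<close>

lemma perp_swap:
  assumes P: "p \<in> P" "s \<in> P" "t \<in> P"
    and ps: "p \<sim> s" and pt: "p \<sim> t" and st: "s \<bottom> t" "s \<noteq> t"
  obtains r where "r \<in> P" "r \<bottom> p"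
    "\<And>e. e \<in> P \<Longrightarrow> e \<bottom> t \<and> e \<bottom> r \<longleftrightarrow> e \<bottom> s \<and> e \<bottom> t"
proof -
  obtain q where "q \<in> P" "q \<bottom> p" "q \<bottom> s" "q \<sim> t"
    using perp_pair_not_subset[OF assms] .
  then show ?thesis
    using perp_swap_core[OF P _ ps pt st] that by metis
qed

section \<open>The exchange property\<close>

text \<open>A failure at \<open>q\<close> puts {q,s}^perp inside \<open>u\<close>-perp, which is
  \<open>claim\<close>. Condition (b) supplies \<open>g\<close> in \<open>s\<close>-perp outside
  \<open>u\<close>-perp, and two swaps lead from \<open>g\<close> to a point \<open>z\<close> of
  {q,s}^perp for which \<open>u \<bottom> z\<close> still forces
  \<open>u \<bottom> g\<close>.\<close>

lemma perp_pair_exchange: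
  assumes P: "s \<in> P" "t \<in> P" "u \<in> P"
    and st: "s \<bottom> t" and us: "u \<noteq> s"
    and sub: "\<And>e. e \<in> P \<Longrightarrow> e \<bottom> s \<Longrightarrow> e \<bottom> t \<Longrightarrow> e \<bottom> u"
    and q: "q \<in> P" "q \<bottom> s" "q \<bottom> u"
  shows "q \<bottom> t"
proof (rule ccontr)
  assume "\<not> q \<bottom> t"
  then have qt: "q \<sim> t"
    by (simp add: orth_iff)
  have claim: "g \<bottom> u" if g: "g \<in> P" "g \<bottom> q" "g \<bottom> s" for g
  proof (rule ccontr)
    assume gu: "\<not> g \<bottom> u"
    then have gt: "g \<sim> t"
      using sub[OF g(1,3)] orth_iff by blast
    have "g \<noteq> q"
      using gu q(3) by blast
    then obtain r where r: "r \<in> P" "r \<bottom> t"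
      "\<And>e. e \<in> P \<Longrightarrow> e \<bottom> q \<and> e \<bottom> r \<longleftrightarrow> e \<bottom> g \<and> e \<bottom> q"
      using perp_swap[OF P(2) g(1) q(1) col_sym[OF gt] col_sym[OF qt] g(2)] by blast
    have "r \<bottom> s"
      using r(3)[OF P(1)] g(3) q(2) orth_sym by blast
    then have "u \<bottom> r"
      using sub r orth_sym by blast
    then have "u \<bottom> g"
      using r(3)[OF P(3)] q(3) orth_sym by blast
    then show False
      using gu orth_sym by blast
  qed
  obtain g where g: "g \<in> P" "g \<bottom> s" "g \<sim> u"
    using not_perp_subset[OF P(1,3) us[symmetric]] .
  have gt: "g \<sim> t"
    using sub[OF g(1,2)] g(3) orth_iff by blast
  have tu: "t \<bottom> u"
    using sub[OF P(2)] orth_sym[OF st] orth_refl by blast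
  have su: "s \<bottom> u"
    using sub[OF P(1) orth_refl st] .
  have "t \<noteq> u"
    using qt q(3) orth_iff by blast
  \<comment> \<open>Swapping \<open>g\<close> about \<open>q\<close> requires a partner
    perpendicular to \<open>g\<close>, which \<open>t\<close> is not. Its replacement
    \<open>t1\<close> is, and it keeps \<open>s \<bottom> t1\<close>, \<open>u \<bottom> t1\<close>
    and \<open>q \<sim> t1\<close>.\<close>
  then obtain t1 where t1: "t1 \<in> P" "t1 \<bottom> g"
    "\<And>e. e \<in> P \<Longrightarrow> e \<bottom> u \<and> e \<bottom> t1 \<longleftrightarrow> e \<bottom> t \<and> e \<bottom> u"
    using perp_swap[OF g(1) P(2,3) gt g(3) tu] by blast
  have st1: "s \<bottom> t1"
    using t1(3)[OF P(1)] st su by blast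
  have ut1: "u \<bottom> t1"
    using t1(3)[OF P(3)] tu orth_sym orth_refl by blast
  have qt1: "q \<sim> t1"
    using t1(3)[OF q(1)] q(3) qt orth_iff by blast
  have qg: "q \<sim> g"
    using claim[OF g(1) _ g(2)] g(3) orth_iff orth_sym by blast
  have "g \<noteq> t1"
    using g(3) ut1 orth_iff orth_sym by blast
  then obtain z where z: "z \<in> P" "z \<bottom> q"
    "\<And>e. e \<in> P \<Longrightarrow> e \<bottom> t1 \<and> e \<bottom> z \<longleftrightarrow> e \<bottom> g \<and> e \<bottom> t1"
    using perp_swap[OF q(1) g(1) t1(1) qg qt1 orth_sym[OF t1(2)]] by blast
  have "z \<bottom> s"
    using z(3)[OF P(1)] st1 g(2) orth_sym by blast
  then have "u \<bottom> z"
    using claim z orth_sym by blast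
  then have "u \<bottom> g"
    using z(3)[OF P(3)] ut1 by blast
  then show False
    using g(3) orth_iff orth_sym by blast
qed

section \<open>The polar space of singular lines\<close>

text \<open>For \<open>s \<bottom> t\<close> these are the lines of the polar space. For
  \<open>s \<sim> t\<close> the same formula is a hyperbolic line, and
  \<open>lines_eq_hyperbolic_lines\<close> uses it so.\<close>

abbreviation singular_line where
  "singular_line s t \<equiv> perp P (orth L) (perp P (orth L) {s, t})"

lemma singular_line_iff:
  "u \<in> singular_line s t \<longleftrightarrow> u \<in> P \<and> (\<forall>e\<in>P. e \<bottom> s \<and> e \<bottom> t \<longrightarrow> e \<bottom> u)"
  using orth_sym by (auto simp: perp_iff)

text \<open>Exchange is applied twice: \<open>base\<close> replaces \<open>t\<close> by a point
  other than \<open>s\<close>, then \<open>main\<close> replaces \<open>s\<close>. One of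
  \<open>u\<close>, \<open>v\<close> differs from \<open>s\<close> and can be replaced for
  \<open>t\<close> first.\<close>

lemma singular_line_perp_eq:
  assumes P: "s \<in> P" "t \<in> P" and st: "s \<bottom> t"
    and u: "u \<in> singular_line s t" and v: "v \<in> singular_line s t" and uv: "u \<noteq> v"
  shows "perp P (orth L) {u, v} = perp P (orth L) {s, t}"
proof -
  have base: "e \<bottom> s \<and> e \<bottom> w \<longleftrightarrow> e \<bottom> s \<and> e \<bottom> t"
    if w: "w \<in> singular_line s t" "w \<noteq> s" and e: "e \<in> P" for w e
  proof -
    have "w \<in> P" and sub: "\<And>f. f \<in> P \<Longrightarrow> f \<bottom> s \<Longrightarrow> f \<bottom> t \<Longrightarrow> f \<bottom> w"
      using w(1) unfolding singular_line_iff by auto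
    then show ?thesis
      using perp_pair_exchange[OF P \<open>w \<in> P\<close> st w(2) sub e] sub[OF e] by blast
  qed
  have main: "e \<bottom> a \<and> e \<bottom> b \<longleftrightarrow> e \<bottom> s \<and> e \<bottom> t"
    if ab: "a \<in> singular_line s t" "b \<in> singular_line s t" "a \<noteq> b" "a \<noteq> s" and e: "e \<in> P"
    for a b e
  proof -
    have aP: "a \<in> P" "b \<in> P"
      using ab singular_line_iff by blast+
    have "s \<bottom> a"
      using ab(1) P(1) st orth_refl unfolding singular_line_iff by blast
    then have sa: "a \<bottom> s"
      by (rule orth_sym)
    have sub: "f \<bottom> b" if f: "f \<in> P" "f \<bottom> a" "f \<bottom> s" for f
    proof -
      have "f \<bottom> t"
        using base[OF ab(1,4) f(1)] f(2,3) by blast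
      then show ?thesis
        using ab(2) f(1,3) unfolding singular_line_iff by blast
    qed
    have "e \<bottom> a \<and> e \<bottom> b \<longleftrightarrow> e \<bottom> a \<and> e \<bottom> s"
      using perp_pair_exchange[OF aP(1) P(1) aP(2) sa ab(3)[symmetric] sub e] sub[OF e] by blast
    then show ?thesis
      using base[OF ab(1,4) e] by blast
  qed
  have "e \<bottom> u \<and> e \<bottom> v \<longleftrightarrow> e \<bottom> s \<and> e \<bottom> t" if "e \<in> P" for e
  proof (cases "u = s")
    case True
    then show ?thesis
      using main[OF v u uv[symmetric] _ that] uv by blast
  next
    case False
    then show ?thesis
      using main[OF u v uv _ that] by blast
  qed
  then show ?thesis
    unfolding perp_def by (intro Collect_cong conj_cong refl) simp
qed

definition singular_lines where
  "singular_lines = {singular_line s t | s t. s \<in> P \<and> t \<in> P \<and> s \<noteq> t \<and> s \<bottom> t}"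

lemma singular_linesE:
  assumes "l \<in> singular_lines"
  obtains s t where "s \<in> P" "t \<in> P" "s \<noteq> t" "s \<bottom> t" "l = singular_line s t"
  using assms by (auto simp: singular_lines_def)

lemma singular_line_ends:
  "s \<in> P \<Longrightarrow> t \<in> P \<Longrightarrow> s \<in> singular_line s t \<and> t \<in> singular_line s t"
  by (simp add: singular_line_iff)

lemma singular_lines_eq:
  assumes "l \<in> singular_lines" "u \<in> l" "v \<in> l" "u \<noteq> v"
  shows "l = singular_line u v"
proof -
  obtain s t where st: "s \<in> P" "t \<in> P" "s \<noteq> t" "s \<bottom> t" "l = singular_line s t"
    using singular_linesE[OF assms(1)] .
  then show ?thesis
    using singular_line_perp_eq[OF st(1,2,4)] assms(2-4) by simp
qed

text \<open>As \<open>s \<bottom> t\<close>, both lie in {s,t}^perp, hence every point of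
  {s,t}^perp^perp is perpendicular to both and lies in {s,t}^perp itself.\<close>

lemma singular_lines_orth:
  assumes "l \<in> singular_lines" "u \<in> l" "v \<in> l"
  shows "u \<bottom> v"
proof -
  obtain s t where st: "s \<in> P" "t \<in> P" "s \<bottom> t" "l = singular_line s t"
    using singular_linesE[OF assms(1)] .
  have ends: "s \<bottom> w \<and> t \<bottom> w \<and> w \<in> P" if "w \<in> l" for w
    using that st orth_refl orth_sym[OF st(3)] unfolding st(4) singular_line_iff by blast
  then have "u \<bottom> s" "u \<bottom> t" "u \<in> P"
    using assms(2) orth_sym by blast+
  then show ?thesis
    using assms(3) unfolding st(4) singular_line_iff by blast
qed

lemma singular_lines_subset: "l \<in> singular_lines \<Longrightarrow> l \<subseteq> P"
  by (auto elim!: singular_linesE simp: perp_iff)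

lemma singular_collinear_iff:
  assumes "p \<in> P" "q \<in> P"
  shows "pls_collinear singular_lines p q \<longleftrightarrow> p \<noteq> q \<and> p \<bottom> q"
proof
  assume "pls_collinear singular_lines p q"
  then show "p \<noteq> q \<and> p \<bottom> q"
    using singular_lines_orth by (auto simp: pls_collinear_def)
next
  assume "p \<noteq> q \<and> p \<bottom> q"
  then have "singular_line p q \<in> singular_lines"
    using assms by (auto simp: singular_lines_def)
  then show "pls_collinear singular_lines p q"
    using \<open>p \<noteq> q \<and> p \<bottom> q\<close> singular_line_ends[OF assms] by (auto simp: pls_collinear_def)
qed

lemma singular_pls: "partial_linear_space P singular_lines"
  unfolding partial_linear_space_def
proof (intro conjI ballI impI)
  fix l
  assume l: "l \<in> singular_lines"
  then show "l \<subseteq> P"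
    by (rule singular_lines_subset)
  show "has_at_least 2 l"
    using l by (metis singular_linesE singular_line_ends has_at_least_2I)
qed (metis singular_lines_eq)

text \<open>If \<open>p\<close> is perpendicular to neither \<open>s\<close> nor \<open>t\<close>,
  \<open>perp_swap\<close> gives a point of \<open>l\<close> that it is perpendicular to. A second
  such point forces all of \<open>l\<close>, because \<open>l\<close> is the double perp of any two
  of its points.\<close>

lemma singular_polar:
  assumes p: "p \<in> P" and l: "l \<in> singular_lines" and pl: "p \<notin> l"
  shows "(\<exists>!q. q \<in> l \<and> pls_collinear singular_lines p q)
       \<or> (\<forall>q\<in>l. pls_collinear singular_lines p q)"
proof -
  obtain s t where st: "s \<in> P" "t \<in> P" "s \<noteq> t" "s \<bottom> t" "l = singular_line s t"
    using singular_linesE[OF l] .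
  have iff: "pls_collinear singular_lines p q \<longleftrightarrow> p \<bottom> q" if "q \<in> l" for q
    using singular_collinear_iff[OF p, of q] that pl singular_lines_subset[OF l] by blast
  have "\<exists>q\<in>l. p \<bottom> q"
  proof (cases "p \<sim> s \<and> p \<sim> t")
    case True
    obtain r where r: "r \<in> P" "r \<bottom> p"
      "\<And>e. e \<in> P \<Longrightarrow> e \<bottom> t \<and> e \<bottom> r \<longleftrightarrow> e \<bottom> s \<and> e \<bottom> t"
      using perp_swap[OF p st(1,2) _ _ st(4,3)] True by blast
    then have "r \<in> l"
      using st(5) singular_line_iff by blast
    then show ?thesis
      using r(2) orth_sym by blast
  next
    case False
    then show ?thesis
      using singular_line_ends[OF st(1,2)] st(5) orth_iff by blast
  qed
  moreover have "p \<bottom> w" if "u \<in> l" "v \<in> l" "u \<noteq> v" "p \<bottom> u" "p \<bottom> v" "w \<in> l" for u v w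
    using singular_lines_eq[OF l that(1-3)] that p singular_line_iff by blast
  ultimately show ?thesis
    using iff by metis
qed

text \<open>The two given points provide some \<open>y\<close> other than a supposed radical point
  \<open>x\<close>, and (b) then gives a point collinear to \<open>x\<close> in the original
  geometry.\<close>

lemma singular_nondegenerate:
  assumes "p \<in> P" "q \<in> P" "p \<noteq> q"
  shows "nondegenerate_polar_space P singular_lines"
proof -
  have False if x: "x \<in> P" "\<forall>y\<in>P. x = y \<or> pls_collinear singular_lines x y" for x
  proof -
    obtain y where "y \<in> P" "y \<noteq> x"
      using assms by metis
    then obtain h where "h \<in> P" "h \<sim> x"
      using not_perp_subset x(1) by metis
    then show False
      using x singular_collinear_iff orth_iff orth_refl orth_sym by metis
  qed
  then show ?thesis
    unfolding nondegenerate_polar_space_def polar_space_def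
    using singular_pls singular_polar by blast
qed

lemma polar_graph:
  assumes "p \<in> P" "q \<in> P" "p \<noteq> q" "p \<bottom> q"
  shows "nondegenerate_polar_graph_rank_ge_2 P (orth L)"
  unfolding nondegenerate_polar_graph_rank_ge_2_def
proof (intro exI conjI ballI)
  show "nondegenerate_polar_space P singular_lines"
    using singular_nondegenerate assms by blast
  show "singular_lines \<noteq> {}"
    using assms by (auto simp: singular_lines_def)
  show "(x = y \<or> pls_collinear singular_lines x y) \<longleftrightarrow> x \<bottom> y" if "x \<in> P" "y \<in> P" for x y
    using singular_collinear_iff[OF that] orth_refl by blast
qed

section \<open>The original lines as hyperbolic lines\<close>

lemma line_perp_eq:
  assumes "h \<in> L" "x \<in> h" "y \<in> h" "x \<noteq> y"
  shows "perp P (orth L) h = perp P (orth L) {x, y}"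
proof -
  have "(\<forall>z\<in>h. q \<bottom> z) \<longleftrightarrow> q \<bottom> x \<and> q \<bottom> y" if "q \<in> P" for q
    using perp_line[OF that assms(1-3) _ assms(4)] assms(2,3) by blast
  then show ?thesis
    unfolding perp_def by (intro Collect_cong conj_cong refl) simp
qed

text \<open>By \<open>line_perp_eq\<close>, (e) makes each line the double perp of any two of its
  points, and the pairs of points joined by a line are exactly the pairs not related by
  \<bottom>.\<close>

lemma lines_eq_hyperbolic_lines:
  assumes "\<forall>h\<in>L. h = perp P (orth L) (perp P (orth L) h)"
  shows "L = hyperbolic_lines P (orth L)"
proof (intro equalityI subsetI)
  fix h
  assume h: "h \<in> L"
  then obtain x y where xy: "x \<in> h" "y \<in> h" "x \<noteq> y"
    using pls has_at_least_2E unfolding partial_linear_space_def by metis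
  then have "h = singular_line x y"
    using assms h line_perp_eq by metis
  then show "h \<in> hyperbolic_lines P (orth L)"
    unfolding hyperbolic_lines_def
    using line_points[OF h] xy line_col[OF h] orth_iff by blast
next
  fix h
  assume "h \<in> hyperbolic_lines P (orth L)"
  then obtain x y where xy: "h = singular_line x y" "x \<sim> y"
    by (auto simp: hyperbolic_lines_def orth_iff)
  then obtain l where "l \<in> L" "x \<in> l" "y \<in> l" "x \<noteq> y"
    using colE by metis
  then show "h \<in> L"
    using assms xy line_perp_eq by metis
qed

end

theorem mainTheorem1:
  fixes P :: "'a set" and L :: "'a set set"
  assumes "partial_linear_space P L"
    and "connected_graph P (pls_collinear L)"
    and "connected_graph P (orth L)"
    and "\<exists>p\<in>P. \<exists>q\<in>P. p \<noteq> q \<and> \<not> pls_collinear L p q"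
    and a: "\<forall>l\<in>L. has_at_least 4 l"
    and b: "\<forall>x\<in>P. \<forall>y\<in>P. perp P (orth L) {x} \<subseteq> perp P (orth L) {y} \<longrightarrow> x = y"
    and c: "\<forall>x\<in>P. \<forall>y\<in>P. \<forall>z\<in>P. x \<noteq> y \<and> y \<noteq> z \<and> x \<noteq> z \<and>
              pls_collinear L x y \<and> pls_collinear L y z \<and> orth L x z \<longrightarrow>
              transversal_plane P L (generated P L {x, y, z})"
    and d: "\<forall>x\<in>P. \<forall>\<pi>. transversal_plane P L \<pi> \<longrightarrow>
              (let S = perp P (orth L) {x} \<inter> \<pi> in
                 S = {} \<or> (\<exists>p\<in>P. S = {p}) \<or> S \<in> L \<or> S \<in> transversals P L \<pi> \<or> S = \<pi>)"
  shows "nondegenerate_polar_graph_rank_ge_2 P (orth L) \<and>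
         ((\<forall>h\<in>L. h = perp P (orth L) (perp P (orth L) h)) \<longrightarrow>
            L = hyperbolic_lines P (orth L))"
proof -
  interpret transversal_geometry P L
    by unfold_locales (fact assms)+
  show ?thesis
    using polar_graph lines_eq_hyperbolic_lines assms(4) orth_iff by blast
qed

end
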